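(* Assume that the problem has no integer variables, i.e. $n_i=0$. Let $\boldsymbol{\rho}^*_{\lambda_1}$ (resp. $\boldsymbol{\rho}^*_{\lambda_2}$) be optimal dual variables related to the constraints $A_2\mathbf{x}+\lambda_1D\mathbf{x}\le\mathbf{b}_2$ (resp. $A_2\mathbf{x}+\lambda_2D\mathbf{x}\le\mathbf{b}_2$) when $\mathcal{P}(\lambda)$ is solved optimally for $\lambda=\lambda_1$ (resp. $\lambda=\lambda_2$). Then, for every $\lambda\in[\lambda_1,\lambda_2]$, $$f(\lambda)\ge\ell[(\lambda_1,\lambda_2),(f(\lambda_1),h^L(\boldsymbol{\rho}^*_{\lambda_1},\lambda_2))](\lambda)$$ (when $h^L(\boldsymbol{\rho}^*_{\lambda_1},\lambda_2)$ is finite), and $$f(\lambda)\ge\ell[(\lambda_1,\lambda_2),(f(\lambda_2),h^L(\boldsymbol{\rho}^*_{\lambda_2},\lambda_1))](\lambda)$$ (when $h^L(\boldsymbol{\rho}^*_{\lambda_2},\lambda_1)$ is finite).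
   Context: Let $\mathbf{c}\in\mathbb{R}^n$, $A_1\in\mathbb{R}^{m_1\times n}$, $A_2,D\in\mathbb{R}^{m_2\times n}$, $\mathbf{b}_1\in\mathbb{R}^{m_1}$, $\mathbf{b}_2\in\mathbb{R}^{m_2}$, and real numbers $\lambda_1<\lambda_2$. Since $n_i=0$, $\mathcal{P}(\lambda)$ is the linear program $\min\ \mathbf{c}^t\mathbf{x}$ s.t. $A_1\mathbf{x}\le\mathbf{b}_1$, $(A_2+\lambda D)\mathbf{x}\le\mathbf{b}_2$, $\mathbf{x}\in\mathbb{R}^n$; $f(\lambda)$ is its optimal value (infimum, in $\mathbb{R}\cup\{\pm\infty\}$, $+\infty$ if infeasible). It is assumed that $\mathcal{P}(\lambda_1)$ and $\mathcal{P}(\lambda_2)$ have optimal solutions. The dual of $\mathcal{P}(\lambda)$ is $\max\ \mathbf{b}_1^t\boldsymbol{\sigma}+\mathbf{b}_2^t\boldsymbol{\rho}$ s.t. $A_1^t\boldsymbol{\sigma}+(A_2+\lambda D)^t\boldsymbol{\rho}=\mathbf{c}$, $\boldsymbol{\sigma}\le\mathbf{0}$, $\boldsymbol{\rho}\le\mathbf{0}$; $\boldsymbol{\rho}^*_{\lambda}$ denotes the $\boldsymbol{\rho}$-part of a dual optimal solution. For $\boldsymbol{\rho}\in\mathbb{R}^{m_2}$, $\boldsymbol{\rho}\le\mathbf{0}$, $h^L(\boldsymbol{\rho},\lambda)$ is the optimal value of the Lagrangian relaxation $$\min\ \mathbf{c}^t\mathbf{x}-\boldsymbol{\rho}^t((A_2+\lambda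 D)\mathbf{x}-\mathbf{b}_2)\ \text{ s.t. } A_1\mathbf{x}\le\mathbf{b}_1,\ \mathbf{x}\in\mathbb{R}^n.$$ For real numbers $x_1\neq x_2$ and $y_1,y_2$, the linear interpolation is $\ell[(x_1,x_2),(y_1,y_2)](t)=y_1+(t-x_1)\frac{y_2-y_1}{x_2-x_1}$.
   Formalization: In the second inequality the abscissae are swapped to ℓ[(λ2,λ1),(f(λ2),h^L(ρ*_{λ2},λ1))], so that f(λ2) is the value at λ2; as printed the inequality is false (e.g. min x, 0≤x≤2, (−2+λ)x≤−1, λ1=0, λ2=1, at λ=0). *)

theory Defs
  imports "HOL-Analysis.Analysis"
begin

text \<open>On \<open>real ^ 'k\<close> the order \<open>\<le>\<close> is the componentwise one. Since there are no integer
  variables, \<open>P(\<lambda>)\<close> is a linear program.\<close>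

definition feasible ::
  "real^'n^'p \<Rightarrow> real^'n^'q \<Rightarrow> real^'n^'q \<Rightarrow> real^'p \<Rightarrow> real^'q \<Rightarrow> real \<Rightarrow> real^'n \<Rightarrow> bool" where
  "feasible A1 A2 D b1 b2 lam x \<longleftrightarrow> A1 *v x \<le> b1 \<and> (A2 + lam *\<^sub>R D) *v x \<le> b2"

definition opt_value ::
  "real^'n \<Rightarrow> real^'n^'p \<Rightarrow> real^'n^'q \<Rightarrow> real^'n^'q \<Rightarrow> real^'p \<Rightarrow> real^'q \<Rightarrow> real \<Rightarrow> ereal" where
  "opt_value c A1 A2 D b1 b2 lam = (INF x\<in>{x. feasible A1 A2 D b1 b2 lam x}. ereal (c \<bullet> x))"

definition optimal_solution ::
  "real^'n \<Rightarrow> real^'n^'p \<Rightarrow> real^'n^'q \<Rightarrow> real^'n^'q \<Rightarrow> real^'p \<Rightarrow> real^'q \<Rightarrow> real \<Rightarrow> real^'n \<Rightarrow> bool" where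
  "optimal_solution c A1 A2 D b1 b2 lam x \<longleftrightarrow>
     feasible A1 A2 D b1 b2 lam x \<and> (\<forall>y. feasible A1 A2 D b1 b2 lam y \<longrightarrow> c \<bullet> x \<le> c \<bullet> y)"

definition dual_feasible ::
  "real^'n \<Rightarrow> real^'n^'p \<Rightarrow> real^'n^'q \<Rightarrow> real^'n^'q \<Rightarrow> real \<Rightarrow> real^'p \<Rightarrow> real^'q \<Rightarrow> bool" where
  "dual_feasible c A1 A2 D lam \<sigma> \<rho> \<longleftrightarrow>
     transpose A1 *v \<sigma> + transpose (A2 + lam *\<^sub>R D) *v \<rho> = c \<and> \<sigma> \<le> 0 \<and> \<rho> \<le> 0"

definition dual_optimal ::
  "real^'n \<Rightarrow> real^'n^'p \<Rightarrow> real^'n^'q \<Rightarrow> real^'n^'q \<Rightarrow> real^'p \<Rightarrow> real^'q \<Rightarrow> real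
     \<Rightarrow> real^'p \<Rightarrow> real^'q \<Rightarrow> bool" where
  "dual_optimal c A1 A2 D b1 b2 lam \<sigma> \<rho> \<longleftrightarrow>
     dual_feasible c A1 A2 D lam \<sigma> \<rho> \<and>
     (\<forall>\<sigma>' \<rho>'. dual_feasible c A1 A2 D lam \<sigma>' \<rho>' \<longrightarrow>
        b1 \<bullet> \<sigma>' + b2 \<bullet> \<rho>' \<le> b1 \<bullet> \<sigma> + b2 \<bullet> \<rho>)"

definition lagrangian_value ::
  "real^'n \<Rightarrow> real^'n^'p \<Rightarrow> real^'n^'q \<Rightarrow> real^'n^'q \<Rightarrow> real^'p \<Rightarrow> real^'q
     \<Rightarrow> real^'q \<Rightarrow> real \<Rightarrow> ereal" where
  "lagrangian_value c A1 A2 D b1 b2 \<rho> lam =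
     (INF x\<in>{x. A1 *v x \<le> b1}. ereal (c \<bullet> x - \<rho> \<bullet> ((A2 + lam *\<^sub>R D) *v x - b2)))"

text \<open>The first pair holds the two abscissae, the second pair the ordinates in the same order.\<close>

definition lin_interp :: "real \<times> real \<Rightarrow> real \<times> real \<Rightarrow> real \<Rightarrow> real" where
  "lin_interp xs ys t = fst ys + (t - fst xs) * ((snd ys - fst ys) / (snd xs - fst xs))"

end

theory Submission
  imports Defs
begin

text \<open>For \<open>\<rho> \<le> 0\<close> the Lagrangian \<open>L(x, \<lambda>) = c \<bullet> x - \<rho> \<bullet> ((A2 + \<lambda> D) x - b2)\<close> is affine in \<open>\<lambda>\<close> and
  bounds \<open>c \<bullet> x\<close> from below on the feasible set of \<open>P(\<lambda>)\<close>. Hence \<open>f\<close> dominates the linear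
  interpolation of \<open>inf L(\<cdot>, \<lambda>)\<close> at the two endpoints, and at the endpoint where \<open>\<rho>\<close> is dual optimal
  this infimum is at least the optimal value by strong duality. Strong duality is Farkas' lemma applied to
  the constraints active at a primal optimal solution.\<close>

text \<open>The cone generated by finitely many vectors is closed and convex, so a \<open>v\<close>
  outside it could be strictly separated from it; the negated normal of the separating hyperplane
  would then violate \<open>polar\<close>.\<close>

lemma farkas:
  fixes a :: "'i \<Rightarrow> 'a::euclidean_space"
  assumes "finite I" and polar: "\<And>d. (\<And>i. i \<in> I \<Longrightarrow> a i \<bullet> d \<le> 0) \<Longrightarrow> v \<bullet> d \<le> 0"
  obtains w where "\<And>i. i \<in> I \<Longrightarrow> 0 \<le> w i" "v = (\<Sum>i\<in>I. w i *\<^sub>R a i)"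
proof -
  let ?C = "convex_cone hull (a ` I)"
  let ?K = "{\<Sum>i\<in>I. w i *\<^sub>R a i | w. \<forall>i\<in>I. 0 \<le> w i}"
  have "v \<in> ?C"
  proof (rule ccontr)
    assume "v \<notin> ?C"
    then obtain n \<beta> where v: "n \<bullet> v < \<beta>" and C: "\<forall>x\<in>?C. n \<bullet> x > \<beta>"
      using separating_hyperplane_closed_point[of ?C v] convex_convex_cone_hull
        closed_convex_cone_hull \<open>finite I\<close> by (metis finite_imageI)
    have "\<beta> < 0" using C convex_cone_hull_contains_0[of "a ` I"] by fastforce
    have "a i \<bullet> (- n) \<le> 0" if "i \<in> I" for i
    proof (rule ccontr)
      assume "\<not> a i \<bullet> (- n) \<le> 0"
      then have neg: "n \<bullet> a i < 0" by (simp add: inner_commute)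
      \<comment> \<open>The factor is positive, being a quotient of negative numbers, and scales
        \<open>a i\<close> onto the hyperplane where \<open>n\<close> takes the value
        \<open>\<beta>\<close>, whereas the cone lies strictly above it.\<close>
      have "(\<beta> / (n \<bullet> a i)) *\<^sub>R a i \<in> ?C"
        using neg \<open>\<beta> < 0\<close> that by (intro convex_cone_hull_mul hull_inc) (auto simp: divide_nonpos_neg)
      then show False using C neg by fastforce
    qed
    then have "v \<bullet> (- n) \<le> 0" by (rule polar)
    then show False using v \<open>\<beta> < 0\<close> by (simp add: inner_commute)
  qed
  \<comment> \<open>Minimality of the hull turns membership in the cone into explicit coefficients:
    it suffices that \<open>?K\<close> is a convex cone containing the generators.\<close>
  moreover have "?C \<subseteq> ?K"
  proof (rule hull_minimal)
    show "a ` I \<subseteq> ?K"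
    proof clarify
      fix i assume "i \<in> I"
      then have "a i = (\<Sum>j\<in>I. (if j = i then 1 else 0) *\<^sub>R a j)"
        using \<open>finite I\<close> by (simp add: if_distrib[of "\<lambda>r. r *\<^sub>R _"] cong: if_cong)
      then show "\<exists>w. a i = (\<Sum>j\<in>I. w j *\<^sub>R a j) \<and> (\<forall>j\<in>I. 0 \<le> w j)"
        by (intro exI[of _ "\<lambda>j. if j = i then 1 else 0"]) auto
    qed
    show "convex_cone ?K"
      unfolding convex_cone_iff
    proof (intro conjI ballI allI impI)
      show "0 \<in> ?K" by (auto intro!: exI[of _ "\<lambda>_. 0"])
    next
      fix x y assume "x \<in> ?K" "y \<in> ?K"
      then obtain u w where "\<forall>i\<in>I. 0 \<le> u i" "x = (\<Sum>i\<in>I. u i *\<^sub>R a i)"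
        "\<forall>i\<in>I. 0 \<le> w i" "y = (\<Sum>i\<in>I. w i *\<^sub>R a i)" by auto
      then show "x + y \<in> ?K"
        by (auto intro!: exI[of _ "\<lambda>i. u i + w i"] simp: scaleR_add_left sum.distrib)
    next
      fix x and r :: real assume "x \<in> ?K" "0 \<le> r"
      then obtain u where "\<forall>i\<in>I. 0 \<le> u i" "x = (\<Sum>i\<in>I. u i *\<^sub>R a i)" by auto
      then show "r *\<^sub>R x \<in> ?K"
        using \<open>0 \<le> r\<close> by (auto intro!: exI[of _ "\<lambda>i. r * u i"] simp: scaleR_sum_right)
    qed
  qed
  ultimately show thesis using that by blast
qed

text \<open>A direction that increases no active constraint stays feasible for small steps, so the
  objective cannot decrease along it. The multipliers vanish on inactive constraints, hence the dual
  value equals the primal one.\<close>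

lemma lp_strong_duality:
  fixes a :: "'i \<Rightarrow> 'a::euclidean_space"
  assumes "finite I" and feas: "\<And>i. i \<in> I \<Longrightarrow> a i \<bullet> x \<le> b i"
    and opt: "\<And>z. (\<And>i. i \<in> I \<Longrightarrow> a i \<bullet> z \<le> b i) \<Longrightarrow> c \<bullet> x \<le> c \<bullet> z"
  obtains y where "\<And>i. i \<in> I \<Longrightarrow> y i \<le> 0" "(\<Sum>i\<in>I. y i *\<^sub>R a i) = c" "(\<Sum>i\<in>I. y i * b i) = c \<bullet> x"
proof -
  define J where "J = {i \<in> I. a i \<bullet> x = b i}"
  have J: "finite J" "J \<subseteq> I" using \<open>finite I\<close> by (auto simp: J_def)
  have polar: "(- c) \<bullet> d \<le> 0" if d: "\<And>i. i \<in> J \<Longrightarrow> a i \<bullet> d \<le> 0" for d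
  proof -
    \<comment> \<open>Active constraints hold for every positive step, slack ones for small steps by
      continuity; finiteness of \<open>I\<close> then yields a common step.\<close>
    have "eventually (\<lambda>e. a i \<bullet> (x + e *\<^sub>R d) \<le> b i) (at_right 0)" if "i \<in> I" for i
    proof (cases "i \<in> J")
      case True
      show ?thesis
        using eventually_at_right_less[of "0::real"]
        by eventually_elim (use True d[OF True] in
          \<open>auto simp: J_def inner_add_right mult_nonneg_nonpos\<close>)
    next
      case False
      have "((\<lambda>e. a i \<bullet> (x + e *\<^sub>R d)) \<longlongrightarrow> a i \<bullet> (x + 0 *\<^sub>R d)) (at_right 0)"
        by (intro tendsto_intros)
      moreover have "a i \<bullet> (x + 0 *\<^sub>R d) < b i" using False feas[OF that] that by (simp add: J_def)
      ultimately have "eventually (\<lambda>e. a i \<bullet> (x + e *\<^sub>R d) < b i) (at_right 0)"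
        by (rule order_tendstoD)
      then show ?thesis by eventually_elim simp
    qed
    then have "eventually (\<lambda>e. \<forall>i\<in>I. a i \<bullet> (x + e *\<^sub>R d) \<le> b i) (at_right 0)"
      using \<open>finite I\<close> by (simp add: eventually_ball_finite)
    then have "eventually (\<lambda>e. 0 < e \<and> (\<forall>i\<in>I. a i \<bullet> (x + e *\<^sub>R d) \<le> b i)) (at_right 0)"
      using eventually_at_right_less eventually_conj by blast
    then obtain e where e: "0 < e" "\<forall>i\<in>I. a i \<bullet> (x + e *\<^sub>R d) \<le> b i"
      using eventually_happens' trivial_limit_at_right_real by blast
    have "c \<bullet> x \<le> c \<bullet> (x + e *\<^sub>R d)" using e by (intro opt) blast
    then show ?thesis using e by (simp add: inner_add_right zero_le_mult_iff)
  qed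
  obtain w where w: "\<And>i. i \<in> J \<Longrightarrow> 0 \<le> w i" "- c = (\<Sum>i\<in>J. w i *\<^sub>R a i)"
    using farkas[OF J(1) polar] by blast
  \<comment> \<open>Farkas represents \<open>- c\<close> with nonnegative weights; the sign change
    gives nonpositive multipliers for \<open>c\<close>. The value 0 outside \<open>J\<close> is
    complementary slackness, which allows \<open>b i\<close> to be replaced by
    \<open>a i \<bullet> x\<close> below.\<close>
  define y where "y i = (if i \<in> J then - w i else 0)" for i
  have "(\<Sum>i\<in>I. y i *\<^sub>R a i) = (\<Sum>i\<in>J. - (w i *\<^sub>R a i))"
    using \<open>finite I\<close> J by (intro sum.mono_neutral_cong_right) (auto simp: y_def)
  then have c: "(\<Sum>i\<in>I. y i *\<^sub>R a i) = c" using w(2) by (simp add: sum_negf) (metis minus_minus)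
  have "(\<Sum>i\<in>I. y i * b i) = (\<Sum>i\<in>I. y i * (a i \<bullet> x))"
    by (intro sum.cong) (auto simp: y_def J_def)
  also have "\<dots> = c \<bullet> x" by (simp add: c[symmetric] inner_sum_left)
  finally show thesis using that[of y] c w(1) by (simp add: y_def)
qed

lemma vector_matrix_mult_sum:
  fixes A :: "real^'n^'m"
  shows "y v* A = (\<Sum>i\<in>UNIV. y $ i *\<^sub>R A $ i)"
  by (simp add: vector_matrix_mult_def vec_eq_iff sum_component mult.commute)

text \<open>Strong duality provides a dual feasible pair of value \<open>c \<bullet> x\<close>, and
  the given dual optimal pair is at least as good.\<close>

lemma dual_optimal_value_ge:
  fixes A1 :: "real^'n^'p" and A2 D :: "real^'n^'q"
  assumes x: "optimal_solution c A1 A2 D b1 b2 lam x"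
    and dual: "dual_optimal c A1 A2 D b1 b2 lam \<sigma> \<rho>"
  shows "c \<bullet> x \<le> b1 \<bullet> \<sigma> + b2 \<bullet> \<rho>"
proof -
  let ?M = "A2 + lam *\<^sub>R D"
  \<comment> \<open>The sum type \<open>'p + 'q\<close> indexes the rows of both constraint blocks
    as a single system.\<close>
  let ?a = "case_sum (($) A1) (($) ?M)" and ?b = "case_sum (($) b1) (($) b2)"
  have all_iff: "(\<forall>i. ?a i \<bullet> z \<le> ?b i) \<longleftrightarrow> feasible A1 A2 D b1 b2 lam z" for z
    unfolding feasible_def less_eq_vec_def matrix_vector_mul_component by (simp add: split_sum_all)
  have sum: "(\<Sum>i\<in>UNIV. g i) = (\<Sum>i\<in>UNIV. g (Inl i)) + (\<Sum>i\<in>UNIV. g (Inr i))"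
    for g :: "'p + 'q \<Rightarrow> 'x::comm_monoid_add"
    using sum.Plus[of UNIV UNIV g] by (simp add: UNIV_Plus_UNIV comp_def)
  obtain y where y: "\<And>i. y i \<le> 0" "(\<Sum>i\<in>UNIV. y i *\<^sub>R ?a i) = c" "(\<Sum>i\<in>UNIV. y i * ?b i) = c \<bullet> x"
  proof (rule lp_strong_duality[of UNIV ?a x ?b c])
    show "?a i \<bullet> x \<le> ?b i" for i
      using x all_iff[of x] unfolding optimal_solution_def by blast
    show "c \<bullet> x \<le> c \<bullet> z" if "\<And>i. i \<in> UNIV \<Longrightarrow> ?a i \<bullet> z \<le> ?b i" for z
      using x all_iff[of z] that unfolding optimal_solution_def by blast
  qed auto
  define \<sigma>' \<rho>' where "\<sigma>' = (\<chi> i. y (Inl i))" and "\<rho>' = (\<chi> i. y (Inr i))"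
  have "dual_feasible c A1 A2 D lam \<sigma>' \<rho>'"
    using y(1,2) by (simp add: dual_feasible_def vector_matrix_mult_sum sum
        \<sigma>'_def \<rho>'_def less_eq_vec_def)
  then have "b1 \<bullet> \<sigma>' + b2 \<bullet> \<rho>' \<le> b1 \<bullet> \<sigma> + b2 \<bullet> \<rho>"
    using dual by (simp add: dual_optimal_def)
  moreover have "b1 \<bullet> \<sigma>' + b2 \<bullet> \<rho>' = c \<bullet> x"
    using y(3) by (simp add: sum inner_vec_def \<sigma>'_def \<rho>'_def mult.commute)
  ultimately show ?thesis by simp
qed

lemma inner_le_nonpos_left:
  fixes u v w :: "real^'k"
  assumes "u \<le> 0" "v \<le> w"
  shows "u \<bullet> w \<le> u \<bullet> v"
  unfolding inner_vec_def using assms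
  by (intro sum_mono) (simp add: less_eq_vec_def mult_left_mono_neg)

text \<open>The dual equation splits \<open>c \<bullet> x\<close> into a \<sigma>-term and a
  \<rho>-term. The latter cancels against the penalty, so only the first block of constraints is
  required of \<open>x\<close>.\<close>

lemma dual_value_le_lagrangian:
  assumes "dual_feasible c A1 A2 D lam \<sigma> \<rho>" "A1 *v x \<le> b1"
  shows "b1 \<bullet> \<sigma> + b2 \<bullet> \<rho> \<le> c \<bullet> x - \<rho> \<bullet> ((A2 + lam *\<^sub>R D) *v x - b2)"
proof -
  have "c \<bullet> x = \<sigma> \<bullet> (A1 *v x) + \<rho> \<bullet> ((A2 + lam *\<^sub>R D) *v x)"
    using assms(1) by (auto simp: dual_feasible_def inner_add_left dot_lmul_matrix)
  moreover have "\<sigma> \<bullet> b1 \<le> \<sigma> \<bullet> (A1 *v x)"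
    using assms by (intro inner_le_nonpos_left) (auto simp: dual_feasible_def)
  ultimately show ?thesis by (simp add: inner_diff_right inner_commute)
qed

lemma opt_value_eq:
  assumes "optimal_solution c A1 A2 D b1 b2 lam x"
  shows "opt_value c A1 A2 D b1 b2 lam = ereal (c \<bullet> x)"
  unfolding opt_value_def using assms
  by (intro antisym INF_greatest INF_lower) (auto simp: optimal_solution_def)

text \<open>The order of \<open>lamA\<close> and \<open>lamB\<close> is left open: only the relative
  position of \<open>lam\<close> matters, so both halves of the theorem are instances, with the
  endpoints exchanged.\<close>

lemma opt_value_ge_lin_interp:
  assumes t: "0 \<le> (lam - lamA) / (lamB - lamA)" "(lam - lamA) / (lamB - lamA) \<le> 1"
    and "lamA \<noteq> lamB"
    and opt: "optimal_solution c A1 A2 D b1 b2 lamA x0"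
    and dual: "dual_optimal c A1 A2 D b1 b2 lamA \<sigma> \<rho>"
    and fin: "\<bar>lagrangian_value c A1 A2 D b1 b2 \<rho> lamB\<bar> \<noteq> \<infinity>"
  shows "ereal (lin_interp (lamA, lamB)
           (real_of_ereal (opt_value c A1 A2 D b1 b2 lamA),
            real_of_ereal (lagrangian_value c A1 A2 D b1 b2 \<rho> lamB)) lam)
         \<le> opt_value c A1 A2 D b1 b2 lam"
  unfolding opt_value_def[of _ _ _ _ _ _ lam]
proof (rule INF_greatest)
  fix x assume "x \<in> {x. feasible A1 A2 D b1 b2 lam x}"
  then have x: "A1 *v x \<le> b1" "(A2 + lam *\<^sub>R D) *v x \<le> b2" by (auto simp: feasible_def)
  define t where "t = (lam - lamA) / (lamB - lamA)"
  define L where "L \<mu> = c \<bullet> x - \<rho> \<bullet> ((A2 + \<mu> *\<^sub>R D) *v x - b2)" for \<mu>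
  \<comment> \<open>Finiteness matters here: \<open>real_of_ereal\<close> would send an infinite
    value to 0.\<close>
  obtain h where h: "lagrangian_value c A1 A2 D b1 b2 \<rho> lamB = ereal h"
    using fin by (cases "lagrangian_value c A1 A2 D b1 b2 \<rho> lamB") auto
  have lam: "lam = lamA + t * (lamB - lamA)" using \<open>lamA \<noteq> lamB\<close> by (simp add: t_def)
  have feas: "dual_feasible c A1 A2 D lamA \<sigma> \<rho>" using dual by (simp add: dual_optimal_def)
  have "c \<bullet> x0 \<le> L lamA"
    using dual_optimal_value_ge[OF opt dual] dual_value_le_lagrangian[OF feas x(1), of b2]
    by (simp add: L_def)
  moreover have "h \<le> L lamB"
    using INF_lower[of x "{x. A1 *v x \<le> b1}" "\<lambda>x. ereal (c \<bullet> x - \<rho> \<bullet> ((A2 + lamB *\<^sub>R D) *v x - b2))"]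
      x(1) h by (simp add: lagrangian_value_def L_def)
  ultimately have "(1 - t) * (c \<bullet> x0) + t * h \<le> (1 - t) * L lamA + t * L lamB"
    using assms(1,2) by (intro add_mono mult_left_mono) (auto simp: t_def)
  \<comment> \<open>For fixed \<open>x\<close>, \<open>L\<close> is affine in its argument.\<close>
  also have "\<dots> = L lam"
    by (simp add: L_def lam matrix_vector_mult_add_rdistrib scaleR_matrix_vector_assoc[symmetric]
        inner_add_right inner_diff_right algebra_simps)
  \<comment> \<open>Both \<open>\<rho>\<close> and the residual of the second block are nonpositive
    at a feasible \<open>x\<close>, so a nonnegative amount is subtracted.\<close>
  also have "L lam \<le> c \<bullet> x"
    using inner_le_nonpos_left[OF _ x(2), of \<rho>] feas
    by (simp add: L_def dual_feasible_def inner_diff_right)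
  finally have "(1 - t) * (c \<bullet> x0) + t * h \<le> c \<bullet> x" .
  moreover have "lin_interp (lamA, lamB) (c \<bullet> x0, h) lam = (1 - t) * (c \<bullet> x0) + t * h"
    by (simp add: lin_interp_def t_def algebra_simps diff_divide_distrib)
  ultimately show "ereal (lin_interp (lamA, lamB)
           (real_of_ereal (opt_value c A1 A2 D b1 b2 lamA),
            real_of_ereal (lagrangian_value c A1 A2 D b1 b2 \<rho> lamB)) lam) \<le> ereal (c \<bullet> x)"
    by (simp add: opt_value_eq[OF opt] h)
qed

text \<open>In the second interpolation the abscissae are listed as \<open>(lam2, lam1)\<close>, so
  that each ordinate stands over the parameter at which it is evaluated.\<close>

theorem theorem7:
  fixes c :: "real^'n"
    and A1 :: "real^'n^'p" and A2 D :: "real^'n^'q"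
    and b1 :: "real^'p" and b2 :: "real^'q"
    and lam1 lam2 :: real
    and \<sigma>1 \<sigma>2 :: "real^'p" and \<rho>1 \<rho>2 :: "real^'q"
  assumes "lam1 < lam2"
    and "\<exists>x. optimal_solution c A1 A2 D b1 b2 lam1 x"
    and "\<exists>x. optimal_solution c A1 A2 D b1 b2 lam2 x"
    and "dual_optimal c A1 A2 D b1 b2 lam1 \<sigma>1 \<rho>1"
    and "dual_optimal c A1 A2 D b1 b2 lam2 \<sigma>2 \<rho>2"
  shows "\<forall>lam \<in> {lam1..lam2}.
    (\<bar>lagrangian_value c A1 A2 D b1 b2 \<rho>1 lam2\<bar> \<noteq> \<infinity> \<longrightarrow>
       opt_value c A1 A2 D b1 b2 lam \<ge>
         ereal (lin_interp (lam1, lam2)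
           (real_of_ereal (opt_value c A1 A2 D b1 b2 lam1),
            real_of_ereal (lagrangian_value c A1 A2 D b1 b2 \<rho>1 lam2)) lam)) \<and>
    (\<bar>lagrangian_value c A1 A2 D b1 b2 \<rho>2 lam1\<bar> \<noteq> \<infinity> \<longrightarrow>
       opt_value c A1 A2 D b1 b2 lam \<ge>
         ereal (lin_interp (lam2, lam1)
           (real_of_ereal (opt_value c A1 A2 D b1 b2 lam2),
            real_of_ereal (lagrangian_value c A1 A2 D b1 b2 \<rho>2 lam1)) lam))"
proof (intro ballI conjI impI)
  fix lam assume lam: "lam \<in> {lam1..lam2}"
  obtain x1 x2 where x: "optimal_solution c A1 A2 D b1 b2 lam1 x1"
    "optimal_solution c A1 A2 D b1 b2 lam2 x2" using assms by blast
  note d = assms(1) assms(4,5)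
  show "opt_value c A1 A2 D b1 b2 lam \<ge>
         ereal (lin_interp (lam1, lam2)
           (real_of_ereal (opt_value c A1 A2 D b1 b2 lam1),
            real_of_ereal (lagrangian_value c A1 A2 D b1 b2 \<rho>1 lam2)) lam)"
    if "\<bar>lagrangian_value c A1 A2 D b1 b2 \<rho>1 lam2\<bar> \<noteq> \<infinity>"
    using lam d by (intro opt_value_ge_lin_interp[OF _ _ _ x(1) _ that]) auto
  show "opt_value c A1 A2 D b1 b2 lam \<ge>
         ereal (lin_interp (lam2, lam1)
           (real_of_ereal (opt_value c A1 A2 D b1 b2 lam2),
            real_of_ereal (lagrangian_value c A1 A2 D b1 b2 \<rho>2 lam1)) lam)"
    if "\<bar>lagrangian_value c A1 A2 D b1 b2 \<rho>2 lam1\<bar> \<noteq> \<infinity>"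
    \<comment> \<open>Numerator and denominator of the relative position are now both nonpositive,
      and the quotient still lies between 0 and 1.\<close>
    using lam d by (intro opt_value_ge_lin_interp[OF _ _ _ x(2) _ that])
      (auto simp: divide_nonpos_neg)
qed

end
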